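(* The maps $\nu_4:\mathrm{Gr}_2(\mathbb{R}^4)\to \mathbb{R}\mathrm{P}^{2}$ and $\nu_8:\mathrm{Gr}_2(\mathbb{R}^8)\to \mathbb{R}\mathrm{P}^{6}$, given by $\langle x,y\rangle\mapsto\left[\frac12(y\bar x-x\bar y)\right]$ (with quaternionic multiplication for $\nu_4$ and octonionic multiplication for $\nu_8$), are submersions.
   Context: $\mathrm{Gr}_2(\mathbb{R}^n)$ is the (smooth) Grassmannian of $2$-dimensional linear subspaces of $\mathbb{R}^n$; $\langle x,y\rangle$ is the plane spanned by linearly independent $x,y$. Let $\mathbb{H}\cong\mathbb{R}^4$ be the quaternions, with conjugation $x\mapsto\bar x$; the pure quaternions ($\bar u=-u$) are identified with $\mathbb{R}^3$. The map $\nu_4:\mathrm{Gr}_2(\mathbb{R}^4)\to\mathbb{R}\mathrm{P}^2$ is $\nu_4(\langle x,y\rangle)=[\frac12(y\bar x-x\bar y)]$ for $x,y\in\mathbb{H}$, where $[u]$ is the class of the nonzero pure quaternion $u$ in $\mathbb{R}\mathrm{P}^2=(\mathbb{R}^3\setminus\{0\})/(u\sim\lambda u,\ \lambda\in\mathbb{R}\setminus\{0\})$. It is well defined. Let $\mathbb{O}\cong\mathbb{R}^8$ be the octonions with canonical basis $e_0,\dots,e_7$, where $e_0$ is the unit, $e_i^2=-e_0$ for $i\ge1$, $e_ie_j=-e_je_i$ for distinct $i,j\geq 1$, and $e_ie_j=e_k$, $e_je_k=e_i$, $e_ke_i=e_j$ for each triple $(i,j,k)\in\{(1,2,3),(1,4,5),(1,7,6),(2,4,6),(2,5,7),(3,4,7),(3,6,5)\}$.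 The conjugate of $x=\sum x_ie_i$ is $\bar x=x_0e_0-\sum_{i>0}x_ie_i$; the pure octonions ($\bar u=-u$) are identified with $\mathbb{R}^7$. The map $\nu_8:\mathrm{Gr}_2(\mathbb{R}^8)\to\mathbb{R}\mathrm{P}^6$ is $\nu_8(\langle x,y\rangle)=[\frac12(y\bar x-x\bar y)]$ for $x,y\in\mathbb{O}$, with $[u]$ the class in $\mathbb{R}\mathrm{P}^6$ of the nonzero pure octonion $u$. It is well defined. *)

theory Defs
  imports "HOL-Analysis.Analysis"
begin

section \<open>Smooth maps and submersions\<close>

text \<open>For open S: the map f is of class C^k, respectively C^infinity, on S.\<close>

primrec Ck_on :: "nat \<Rightarrow> 'a::euclidean_space set \<Rightarrow> ('a \<Rightarrow> 'b::euclidean_space) \<Rightarrow> bool" where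
  "Ck_on 0 S f \<longleftrightarrow> continuous_on S f"
| "Ck_on (Suc k) S f \<longleftrightarrow>
     (\<forall>x\<in>S. f differentiable (at x)) \<and> (\<forall>v. Ck_on k S (\<lambda>x. frechet_derivative f (at x) v))"

definition smooth_on :: "'a::euclidean_space set \<Rightarrow> ('a \<Rightarrow> 'b::euclidean_space) \<Rightarrow> bool" where
  "smooth_on S f \<longleftrightarrow> (\<forall>k. Ck_on k S f)"

text \<open>
  A chart is a pair of its domain and the coordinate map. A smooth manifold is given by its set
  of points and an atlas of charts (with open images) in a Euclidean space; its topology is the
  one induced by the atlas. Openness of the domains of all local representatives of a map is
  therefore continuity of the map.
\<close>

type_synonym ('p, 'e) chart = "'p set \<times> ('p \<Rightarrow> 'e)"

definition local_rep :: "('p, 'e) chart \<Rightarrow> ('q, 'f) chart \<Rightarrow> ('p \<Rightarrow> 'q) \<Rightarrow> 'e \<Rightarrow> 'f" where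
  "local_rep c d f = snd d \<circ> f \<circ> inv_into (fst c) (snd c)"

definition local_dom :: "('p, 'e) chart \<Rightarrow> ('q, 'f) chart \<Rightarrow> ('p \<Rightarrow> 'q) \<Rightarrow> 'e set" where
  "local_dom c d f = snd c ` {p \<in> fst c. f p \<in> fst d}"

definition smooth_map ::
  "'p set \<Rightarrow> ('p, 'e::euclidean_space) chart set \<Rightarrow> 'q set \<Rightarrow> ('q, 'f::euclidean_space) chart set
    \<Rightarrow> ('p \<Rightarrow> 'q) \<Rightarrow> bool" where
  "smooth_map M A N B f \<longleftrightarrow> f ` M \<subseteq> N \<and>
     (\<forall>c\<in>A. \<forall>d\<in>B. open (local_dom c d f) \<and> smooth_on (local_dom c d f) (local_rep c d f))"

definition submersion ::
  "'p set \<Rightarrow> ('p, 'e::euclidean_space) chart set \<Rightarrow> 'q set \<Rightarrow> ('q, 'f::euclidean_space) chart set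
    \<Rightarrow> ('p \<Rightarrow> 'q) \<Rightarrow> bool" where
  "submersion M A N B f \<longleftrightarrow> smooth_map M A N B f \<and>
     (\<forall>p\<in>M. \<forall>c\<in>A. \<forall>d\<in>B. p \<in> fst c \<longrightarrow> f p \<in> fst d \<longrightarrow>
        surj (frechet_derivative (local_rep c d f) (at (snd c p))))"


section \<open>Grassmannians\<close>

definition grassmannian :: "nat \<Rightarrow> 'a::euclidean_space set set" where
  "grassmannian k = {L. subspace L \<and> dim L = k}"

text \<open>
  The standard smooth structure. A linear isomorphism T from the product of R^k and R^m to R^n
  splits R^n into the k-plane P and the complement Q spanned by the images of the two factors.
  Its chart is defined on the planes that are graphs over P (those meeting Q only in 0) and
  sends such a plane to the m x k matrix of the linear map from P to Q of which it is the graph.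
  The image of the chart is the space of all matrices.
\<close>

definition graph_plane ::
  "((real^'k) \<times> (real^'m) \<Rightarrow> real^'n) \<Rightarrow> real^'k^'m \<Rightarrow> (real^'n) set" where
  "graph_plane T A = T ` range (\<lambda>x. (x, A *v x))"

definition grassmann_chart ::
  "((real^'k) \<times> (real^'m) \<Rightarrow> real^'n) \<Rightarrow> ((real^'n) set, real^'k^'m) chart" where
  "grassmann_chart T = (range (graph_plane T), \<lambda>L. THE A. L = graph_plane T A)"

text \<open>The type of the model space determines k and m; the index types have to satisfy k + m = n
  (otherwise there is no chart).\<close>

definition grassmann_atlas :: "((real^'n) set, real^'k^'m) chart set" where
  "grassmann_atlas = {grassmann_chart T | T. linear T \<and> bij T}"


section \<open>Real projective spaces\<close>

definition proj_rel :: "('a::real_vector \<times> 'a) set" where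
  "proj_rel = {(u, v). u \<noteq> 0 \<and> v \<noteq> 0 \<and> (\<exists>c. c \<noteq> 0 \<and> u = c *\<^sub>R v)}"

definition proj_space :: "'a::real_vector set set" where
  "proj_space = (UNIV - {0}) // proj_rel"

definition proj_class :: "'a::real_vector \<Rightarrow> 'a set" where
  "proj_class u = proj_rel `` {u}"

text \<open>
  Affine charts in arbitrary linear homogeneous coordinates: the class of T (t, w) with t nonzero
  is sent to w / t. The usual charts, dividing by one of the coordinates, are those for which T
  permutes the coordinates. Here m = n - 1.
\<close>

definition proj_chart ::
  "(real \<times> (real^'m) \<Rightarrow> real^'n) \<Rightarrow> ((real^'n) set, real^'m) chart" where
  "proj_chart T = (range (\<lambda>w. proj_class (T (1, w))), \<lambda>c. THE w. c = proj_class (T (1, w)))"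

definition proj_atlas :: "((real^'n) set, real^'m) chart set" where
  "proj_atlas = {proj_chart T | T. linear T \<and> bij T}"


section \<open>The charts cover\<close>

lemma adapted_iso_exists:
  fixes L :: "'a::euclidean_space set"
  assumes "subspace L" "dim L = DIM('p)" "DIM('a) = DIM('p) + DIM('q)"
  obtains T :: "'p::euclidean_space \<times> 'q::euclidean_space \<Rightarrow> 'a" where "linear T" "bij T" "T ` (UNIV \<times> {0}) = L"
proof -
  define C where "C = {y. \<forall>x\<in>L. orthogonal x y}"
  have C: "subspace C"
    unfolding C_def by (rule subspace_orthogonal_to_vectors)
  have "dim C + dim L = DIM('a)"
    using dim_subspace_orthogonal_to_vectors[OF assms(1) subspace_UNIV]
    by (simp add: C_def dim_UNIV)
  then have dimC: "dim C = DIM('q)"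
    using assms by simp
  obtain f :: "'p \<Rightarrow> 'a" where f: "linear f" "f ` UNIV = L" "\<And>x. x \<in> UNIV \<Longrightarrow> norm (f x) = norm x"
    using isometries_subspaces[OF subspace_UNIV assms(1)] assms(2) by (metis dim_UNIV)
  obtain g :: "'q \<Rightarrow> 'a" where g: "linear g" "g ` UNIV = C" "\<And>x. x \<in> UNIV \<Longrightarrow> norm (g x) = norm x"
    using isometries_subspaces[OF subspace_UNIV C] dimC by (metis dim_UNIV)
  define T where "T = (\<lambda>p. f (fst p) + g (snd p))"
  have lin: "linear T"
    unfolding T_def
    by (intro linear_compose_add linear_compose[OF _ f(1), unfolded o_def]
        linear_compose[OF _ g(1), unfolded o_def] linear_fst linear_snd)
  have orth: "f x \<bullet> g y = 0" for x y
  proof -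
    have "f x \<in> L" "g y \<in> C" using f(2) g(2) by auto
    then show ?thesis by (auto simp: C_def orthogonal_def)
  qed
  have "inj T"
    unfolding linear_injective_0[OF lin]
  proof (intro allI impI)
    fix p assume "T p = 0"
    then have *: "f (fst p) + g (snd p) = 0" by (simp add: T_def)
    have "f (fst p) \<bullet> (f (fst p) + g (snd p)) = 0" "g (snd p) \<bullet> (f (fst p) + g (snd p)) = 0"
      by (simp_all add: *)
    then have "f (fst p) = 0" "g (snd p) = 0"
      using orth orth[THEN trans[OF inner_commute]] by (simp_all add: inner_add_right)
    then have "fst p = 0" "snd p = 0"
      using f(3)[of "fst p"] g(3)[of "snd p"] by simp_all
    then show "p = 0" by (simp add: prod_eq_iff)
  qed
  moreover have "surj T"
  proof -
    have "dim (range T) = DIM('a)"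
    proof -
      have "dim (range T) = DIM('p \<times> 'q)"
        using dim_image_eq[OF lin, of UNIV] \<open>inj T\<close> by simp
      then show ?thesis using assms(3) by simp
    qed
    moreover have "subspace (range T)"
      by (simp add: lin linear_subspace_image)
    ultimately show ?thesis
      by (metis dim_eq_full span_eq_iff)
  qed
  moreover have "T ` (UNIV \<times> {0}) = L"
    using f(2) by (force simp: T_def linear_0[OF g(1)])
  ultimately show ?thesis
    using lin that by (simp add: bij_def)
qed

lemma grassmann_charts_cover:
  assumes "CARD('n) = CARD('k) + CARD('m)"
  shows "(\<Union>c\<in>(grassmann_atlas :: ((real^'n::finite) set, real^'k::finite^'m::finite) chart set). fst c)
    = grassmannian CARD('k)"
proof (intro equalityI subsetI)
  fix L assume "L \<in> (\<Union>c\<in>(grassmann_atlas :: ((real^'n) set, real^'k^'m) chart set). fst c)"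
  then obtain T :: "(real^'k) \<times> (real^'m) \<Rightarrow> real^'n" and A
    where T: "linear T" "bij T" and L: "L = T ` range (\<lambda>x. (x, A *v x))"
    by (auto simp: grassmann_atlas_def grassmann_chart_def graph_plane_def)
  have lin: "linear (\<lambda>x. (x, A *v x))"
    by (auto simp: linear_iff matrix_vector_right_distrib matrix_vector_mult_scaleR)
  have "inj (\<lambda>x. (x, A *v x))" by (auto simp: inj_on_def)
  then have "dim (range (\<lambda>x. (x, A *v x))) = CARD('k)"
    using dim_image_eq[OF lin, of UNIV] by (simp add: dim_UNIV)
  then have "dim L = CARD('k)"
    unfolding L using dim_image_eq[OF T(1)] T(2) by (metis bij_is_inj inj_on_subset subset_UNIV)
  then show "L \<in> grassmannian CARD('k)"
    unfolding grassmannian_def L using lin T(1)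
    by (simp add: linear_subspace_image)
next
  fix L :: "(real^'n) set" assume "L \<in> grassmannian CARD('k)"
  then have "subspace L" "dim L = DIM(real^'k)" by (auto simp: grassmannian_def)
  then obtain T :: "(real^'k) \<times> (real^'m) \<Rightarrow> real^'n"
    where T: "linear T" "bij T" "T ` (UNIV \<times> {0}) = L"
    using adapted_iso_exists[where 'p="real^'k" and 'q="real^'m"] assms by (metis DIM_cart DIM_real mult.right_neutral)
  then have "L = graph_plane T 0" by (auto simp: graph_plane_def image_image)
  then have "L \<in> fst (grassmann_chart T)" by (simp add: grassmann_chart_def)
  then show "L \<in> (\<Union>c\<in>(grassmann_atlas :: ((real^'n) set, real^'k^'m) chart set). fst c)"
    using T unfolding grassmann_atlas_def by blast
qed

lemma equiv_proj_rel: "equiv (UNIV - {0} :: 'a::real_vector set) proj_rel"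
proof (rule equivI)
  let ?r = "proj_rel :: ('a \<times> 'a) set"
  show "refl_on (UNIV - {0}) ?r"
    by (auto simp: refl_on_def proj_rel_def intro!: exI[of _ 1])
  show "?r \<subseteq> (UNIV - {0}) \<times> (UNIV - {0})"
    by (auto simp: proj_rel_def)
  show "sym ?r"
  proof (rule symI)
    fix u v :: 'a
    assume "(u, v) \<in> proj_rel"
    then obtain c where "u \<noteq> 0" "v \<noteq> 0" "c \<noteq> 0" "u = c *\<^sub>R v" by (auto simp: proj_rel_def)
    then show "(v, u) \<in> proj_rel" by (auto simp: proj_rel_def intro!: exI[of _ "1 / c"])
  qed
  show "trans ?r"
  proof (rule transI)
    fix u v w :: 'a
    assume "(u, v) \<in> proj_rel" "(v, w) \<in> proj_rel"
    then obtain c d where "u \<noteq> 0" "w \<noteq> 0" "c \<noteq> 0" "d \<noteq> 0" "u = c *\<^sub>R v" "v = d *\<^sub>R w"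
      by (auto simp: proj_rel_def)
    then show "(u, w) \<in> proj_rel" by (auto simp: proj_rel_def intro!: exI[of _ "c * d"])
  qed
qed

lemma proj_charts_cover:
  assumes "CARD('n) = 1 + CARD('m)"
  shows "(\<Union>c\<in>(proj_atlas :: ((real^'n::finite) set, real^'m::finite) chart set). fst c) = proj_space"
proof (intro equalityI subsetI)
  fix P assume "P \<in> (\<Union>c\<in>(proj_atlas :: ((real^'n) set, real^'m) chart set). fst c)"
  then obtain T :: "real \<times> (real^'m) \<Rightarrow> real^'n" and w
    where T: "linear T" "bij T" and P: "P = proj_class (T (1, w))"
    by (auto simp: proj_atlas_def proj_chart_def)
  have "T (1, w) \<noteq> 0"
    using T by (metis bij_is_inj linear_injective_0 one_neq_zero prod.inject zero_prod_def)
  then show "P \<in> proj_space"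
    by (auto simp: P proj_space_def proj_class_def intro: quotientI)
next
  fix P :: "(real^'n) set" assume "P \<in> proj_space"
  then obtain u where u: "u \<noteq> 0" "P = proj_class u"
    by (auto simp: proj_space_def proj_class_def elim: quotientE)
  have "dim (span {u}) = 1" using u(1) by (simp add: dim_span)
  then obtain T :: "real \<times> (real^'m) \<Rightarrow> real^'n"
    where T: "linear T" "bij T" "T ` (UNIV \<times> {0}) = span {u}"
    using adapted_iso_exists[where 'p=real and 'q="real^'m", of "span {u}"] assms
    by (metis DIM_cart DIM_real mult.right_neutral subspace_span)
  have "u \<in> T ` (UNIV \<times> {0})" unfolding T(3) by (simp add: span_base)
  then obtain t where t: "u = T (t, 0)" by auto
  also have "\<dots> = t *\<^sub>R T (1, 0)" using linear_cmul[OF T(1), of t "(1, 0)"] by simp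
  finally have "(T (1, 0), u) \<in> proj_rel"
    using u(1) unfolding proj_rel_def by (auto intro!: exI[of _ "1 / t"])
  then have "P = proj_class (T (1, 0))"
    unfolding u(2) proj_class_def using equiv_class_eq[OF equiv_proj_rel] by auto
  then have "P \<in> fst (proj_chart T)" by (simp add: proj_chart_def)
  then show "P \<in> (\<Union>c\<in>(proj_atlas :: ((real^'n) set, real^'m) chart set). fst c)"
    using T unfolding proj_atlas_def by blast
qed


section \<open>Quaternions and octonions\<close>

text \<open>
  Coordinates in R^4 and R^8 are indexed by the elements 0, ..., 3 and 0, ..., 7 of the numeral
  types 4 and 8, so that e_i is \<open>axis i 1\<close> and e_0 is the unit. The products are given by the
  coefficient of e_k in e_i e_j, for a given set of triples (i, j, k) such that
  e_i e_j = e_k, e_j e_k = e_i, e_k e_i = e_j.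
\<close>

definition cyclic_closure :: "('i \<times> 'i \<times> 'i) set \<Rightarrow> ('i \<times> 'i \<times> 'i) set" where
  "cyclic_closure S = {(i, j, k). (i, j, k) \<in> S \<or> (j, k, i) \<in> S \<or> (k, i, j) \<in> S}"

definition struct_coeff :: "('i::zero \<times> 'i \<times> 'i) set \<Rightarrow> 'i \<Rightarrow> 'i \<Rightarrow> 'i \<Rightarrow> real" where
  "struct_coeff S i j k =
    (if i = 0 then (if k = j then 1 else 0)
     else if j = 0 then (if k = i then 1 else 0)
     else if i = j then (if k = 0 then - 1 else 0)
     else if (i, j, k) \<in> cyclic_closure S then 1
     else if (j, i, k) \<in> cyclic_closure S then - 1
     else 0)"

definition algebra_mult ::
  "('i::{finite,zero} \<times> 'i \<times> 'i) set \<Rightarrow> (real, 'i) vec \<Rightarrow> (real, 'i) vec \<Rightarrow> (real, 'i) vec" where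
  "algebra_mult S x y = (\<chi> k. \<Sum>i\<in>UNIV. \<Sum>j\<in>UNIV. x $ i * y $ j * struct_coeff S i j k)"

lemma algebra_mult_axis:
  fixes i j :: "'i::{finite,zero}"
  shows "algebra_mult S (axis i 1) (axis j 1) = (\<chi> k. struct_coeff S i j k)"
proof -
  have "(\<Sum>a\<in>UNIV. \<Sum>b\<in>UNIV. (axis i 1 :: (real, 'i) vec) $ a * (axis j 1 :: (real, 'i) vec) $ b * struct_coeff S a b k)
      = struct_coeff S i j k" for k
  proof -
    have "(axis i 1 :: (real, 'i) vec) $ a * (axis j 1 :: (real, 'i) vec) $ b * struct_coeff S a b k
        = (if b = j then if a = i then struct_coeff S i j k else 0 else 0)" for a b
      by (simp add: axis_def)
    then show ?thesis by simp
  qed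
  then show ?thesis by (simp add: algebra_mult_def)
qed

definition quat_mult :: "real^4 \<Rightarrow> real^4 \<Rightarrow> real^4" where
  "quat_mult = algebra_mult {(1, 2, 3)}"

definition oct_mult :: "real^8 \<Rightarrow> real^8 \<Rightarrow> real^8" where
  "oct_mult = algebra_mult
     {(1, 2, 3), (1, 4, 5), (1, 7, 6), (2, 4, 6), (2, 5, 7), (3, 4, 7), (3, 6, 5)}"

definition hc_conj :: "(real, 'i::{finite,zero}) vec \<Rightarrow> (real, 'i) vec" where
  "hc_conj x = (\<chi> i. if i = 0 then x $ i else - x $ i)"

text \<open>The identification of the pure elements (those u with \<open>hc_conj u = - u\<close>) with R^3 and R^7.\<close>

definition pure_quat :: "real^4 \<Rightarrow> real^3" where
  "pure_quat u = vector [u $ 1, u $ 2, u $ 3]"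

definition pure_oct :: "real^8 \<Rightarrow> real^7" where
  "pure_oct u = vector [u $ 1, u $ 2, u $ 3, u $ 4, u $ 5, u $ 6, u $ 7]"


section \<open>The maps\<close>

definition nu4 :: "(real^4) set \<Rightarrow> (real^3) set" where
  "nu4 L = (THE c. \<exists>x y. x \<noteq> y \<and> independent {x, y} \<and> L = span {x, y} \<and>
     c = proj_class (pure_quat ((1/2) *\<^sub>R (quat_mult y (hc_conj x) - quat_mult x (hc_conj y)))))"

definition nu8 :: "(real^8) set \<Rightarrow> (real^7) set" where
  "nu8 L = (THE c. \<exists>x y. x \<noteq> y \<and> independent {x, y} \<and> L = span {x, y} \<and>
     c = proj_class (pure_oct ((1/2) *\<^sub>R (oct_mult y (hc_conj x) - oct_mult x (hc_conj y)))))"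

end

(* Write B(x, y) for the imaginary part of y * conj x. It is bilinear and alternating, and
   (y * conj x) * x = |x|^2 y shows that it vanishes only on dependent pairs; by a dimension count
   B(x, -) is therefore onto for x nonzero. In the charts of the splitting T of R^n into P and Q, a
   plane has the basis X(A) = T(e_1, A e_1), Y(A) = T(e_2, A e_2), affine in the matrix A, so that
   the map is a quotient of quadratic polynomials in A. Moving Y alone gives the tangent vectors
   B(X, w) with w in Q, and since R^n is spanned by X, Y and Q, these generate the target modulo
   the line of B(X, Y), which is the kernel of the projectivization. *)

theory Submission
  imports Defs
begin

section \<open>Closure properties of C^k maps on open sets\<close>

section \<open>Calculus of smooth maps\<close>

text \<open>On an open set, derivatives at its points only see values inside it. This lets an
  explicit formula replace a local representative that agrees with it only on its domain.\<close>

lemma Ck_on_cong: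
  assumes "open S" "\<And>x. x \<in> S \<Longrightarrow> f x = g x"
  shows "Ck_on k S f \<longleftrightarrow> Ck_on k S g"
  using assms(2)
proof (induction k arbitrary: f g)
  case 0
  then show ?case by (simp cong: continuous_on_cong)
next
  case (Suc k)
  have *: "(f has_derivative D) (at x) \<longleftrightarrow> (g has_derivative D) (at x)" if "x \<in> S" for x D
    using has_derivative_transform_within_open[OF _ assms(1) that] Suc.prems by metis
  then have "frechet_derivative f (at x) = frechet_derivative g (at x)" if "x \<in> S" for x
    using that by (simp add: frechet_derivative_def)
  then have "Ck_on k S (\<lambda>x. frechet_derivative f (at x) v) \<longleftrightarrow>
      Ck_on k S (\<lambda>x. frechet_derivative g (at x) v)" for v
    by (intro Suc.IH) simp
  then show ?case
    using * by (simp add: differentiable_def)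
qed

text \<open>By uniqueness of the derivative, any explicit \<open>D\<close> may stand in for
  \<open>frechet_derivative\<close>.\<close>

lemma Ck_on_SucI:
  assumes "open S" "\<And>x. x \<in> S \<Longrightarrow> (f has_derivative D x) (at x)" "\<And>v. Ck_on k S (\<lambda>x. D x v)"
  shows "Ck_on (Suc k) S f"
proof -
  have "frechet_derivative f (at x) = D x" if "x \<in> S" for x
    using assms(2)[OF that] by (simp add: frechet_derivative_at[symmetric])
  then have "Ck_on k S (\<lambda>x. frechet_derivative f (at x) v) \<longleftrightarrow> Ck_on k S (\<lambda>x. D x v)" for v
    by (intro Ck_on_cong[OF assms(1)]) simp
  then show ?thesis
    using assms(2,3) by (auto simp: differentiable_def)
qed

text \<open>For the product and quotient rules, where undifferentiated factors survive next to
  derivatives.\<close>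

lemma Ck_on_SucD: "Ck_on (Suc k) S f \<Longrightarrow> Ck_on k S f"
proof (induction k arbitrary: f)
  case 0
  then have "f differentiable_on S"
    by (auto simp: differentiable_on_def intro: differentiable_at_withinI)
  then show ?case
    by (simp add: differentiable_imp_continuous_on)
next
  case (Suc k)
  then show ?case
    by (metis Ck_on.simps(2))
qed

lemma Ck_on_has_derivative:
  "Ck_on (Suc k) S f \<Longrightarrow> x \<in> S \<Longrightarrow> (f has_derivative frechet_derivative f (at x)) (at x)"
  by (simp add: frechet_derivative_works[symmetric] Ck_on.simps(2))

declare Ck_on.simps(2) [simp del]

lemma Ck_on_frechet_derivative: "Ck_on (Suc k) S f \<Longrightarrow> Ck_on k S (\<lambda>x. frechet_derivative f (at x) v)"
  by (simp add: Ck_on.simps(2))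

lemma Ck_on_const: "open S \<Longrightarrow> Ck_on k S (\<lambda>x. c)"
proof (induction k arbitrary: c)
  case (Suc k)
  then show ?case
    by (intro Ck_on_SucI[where D = "\<lambda>x v. 0"]) auto
qed simp

lemma Ck_on_add:
  assumes "open S" "Ck_on k S f" "Ck_on k S g"
  shows "Ck_on k S (\<lambda>x. f x + g x)"
  using assms(2,3)
proof (induction k arbitrary: f g)
  case 0
  then show ?case by (simp add: continuous_on_add)
next
  case (Suc k)
  show ?case
  proof (rule Ck_on_SucI[OF assms(1)])
    show "((\<lambda>x. f x + g x) has_derivative
        (\<lambda>v. frechet_derivative f (at x) v + frechet_derivative g (at x) v)) (at x)" if "x \<in> S" for x
      by (rule has_derivative_add Ck_on_has_derivative Suc.prems that)+
    show "Ck_on k S (\<lambda>x. frechet_derivative f (at x) v + frechet_derivative g (at x) v)" for v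
      by (rule Suc.IH Ck_on_frechet_derivative Suc.prems)+
  qed
qed

text \<open>The derivative of \<open>f\<close> is \<open>f\<close> at every point, hence constant in
  the point for each direction; no induction is involved.\<close>

lemma Ck_on_linear:
  assumes "open S" "linear f"
  shows "Ck_on k S f"
proof (cases k)
  case 0
  then show ?thesis
    using assms(2) by (simp add: linear_continuous_on linear_conv_bounded_linear)
next
  case (Suc j)
  then show ?thesis
    unfolding Suc using assms
    by (intro Ck_on_SucI[where D = "\<lambda>x. f"] Ck_on_const linear_imp_has_derivative)
qed

text \<open>The Leibniz rule yields two summands that are again \<open>h\<close> of C^k maps, which
  is why the induction varies both \<open>f\<close> and \<open>g\<close>. It covers real products,
  scaling and the coordinates of \<open>B\<close> alike.\<close>

lemma Ck_on_bounded_bilinear: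
  assumes "open S" "bounded_bilinear h" "Ck_on k S f" "Ck_on k S g"
  shows "Ck_on k S (\<lambda>x. h (f x) (g x))"
  using assms(3,4)
proof (induction k arbitrary: f g)
  case 0
  then show ?case
    using bounded_bilinear.continuous_on[OF assms(2)] by simp
next
  case (Suc k)
  show ?case
  proof (rule Ck_on_SucI[OF assms(1)])
    show "((\<lambda>x. h (f x) (g x)) has_derivative
        (\<lambda>v. h (f x) (frechet_derivative g (at x) v) + h (frechet_derivative f (at x) v) (g x))) (at x)"
      if "x \<in> S" for x
      by (rule bounded_bilinear.FDERIV[OF assms(2)] Ck_on_has_derivative Suc.prems that)+
    show "Ck_on k S (\<lambda>x. h (f x) (frechet_derivative g (at x) v) + h (frechet_derivative f (at x) v) (g x))" for v
      by (rule Ck_on_add[OF assms(1)] Suc.IH Ck_on_frechet_derivative Suc.prems Ck_on_SucD)+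
  qed
qed

lemma Ck_on_inverse:
  fixes f :: "'a::euclidean_space \<Rightarrow> real"
  assumes "open S" "\<And>x. x \<in> S \<Longrightarrow> f x \<noteq> 0" "Ck_on k S f"
  shows "Ck_on k S (\<lambda>x. inverse (f x))"
  using assms(3)
proof (induction k)
  case 0
  then show ?case
    using assms(2) by (simp add: continuous_on_inverse)
next
  case (Suc k)
  have f: "Ck_on k S (\<lambda>x. frechet_derivative f (at x) v)" for v
    using Suc.prems by (rule Ck_on_frechet_derivative)
  have inv: "Ck_on k S (\<lambda>x. inverse (f x))"
    using Suc Ck_on_SucD by blast
  \<comment> \<open>The sign is a constant factor, so the whole derivative of 1/f is an iterated
    product and the bilinear rule suffices.\<close>
  have "Ck_on k S (\<lambda>x. - 1 * ((inverse (f x) * frechet_derivative f (at x) v) * inverse (f x)))" for v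
    using assms(1) f inv
    by (intro Ck_on_bounded_bilinear[OF _ bounded_bilinear_mult] Ck_on_const)
  moreover have "((\<lambda>x. inverse (f x)) has_derivative
      (\<lambda>v. - (inverse (f x) * frechet_derivative f (at x) v * inverse (f x)))) (at x)" if "x \<in> S" for x
    using assms(2)[OF that] Ck_on_has_derivative[OF Suc.prems that] by (rule Deriv.has_derivative_inverse)
  ultimately show ?case
    by (intro Ck_on_SucI[where D = "\<lambda>x v. - (inverse (f x) * frechet_derivative f (at x) v * inverse (f x))"]
        assms(1)) simp_all
qed

section \<open>Charts\<close>

lemma span_pair: "span {x, y} = {a *\<^sub>R x + b *\<^sub>R y |a b. True}"
proof -
  have "v \<in> span {x, y} \<longleftrightarrow> (\<exists>a b. v = a *\<^sub>R x + b *\<^sub>R y)" for v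
    by (auto simp: span_breakdown_eq algebra_simps)
  then show ?thesis by auto
qed

text \<open>The set \<open>{x, y}\<close> collapses to a singleton when \<open>x = y\<close> and may
  then be independent, so distinctness has to be part of the left side.\<close>

lemma independent_pair_iff:
  "x \<noteq> y \<and> independent {x, y} \<longleftrightarrow> (\<forall>a b. a *\<^sub>R x + b *\<^sub>R y = 0 \<longrightarrow> a = 0 \<and> b = 0)"
  (is "?L \<longleftrightarrow> ?R")
proof
  assume L: ?L
  then have x: "x \<notin> span {y}" and y: "y \<noteq> 0"
    by (auto simp: independent_insert split: if_splits)
  show ?R
  proof (intro allI impI)
    fix a b assume ab: "a *\<^sub>R x + b *\<^sub>R y = 0"
    have "a = 0"
    proof (rule ccontr)
      assume a: "a \<noteq> 0"
      have "x = (1 / a) *\<^sub>R (a *\<^sub>R x + b *\<^sub>R y) - (b / a) *\<^sub>R y"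
        using a by (simp add: algebra_simps)
      then have "x = (- (b / a)) *\<^sub>R y"
        by (simp add: ab)
      then show False
        using x by (metis span_base span_scale singletonI)
    qed
    then show "a = 0 \<and> b = 0"
      using ab y by simp
  qed
next
  assume R: ?R
  have "x \<noteq> y"
    using R[rule_format, of 1 "- 1"] by auto
  moreover have "y \<noteq> 0"
    using R[rule_format, of 0 1] by auto
  moreover have "x \<noteq> k *\<^sub>R y" for k
    using R[rule_format, of 1 "- k"] by auto
  ultimately show ?L
    by (auto simp: independent_insert span_singleton)
qed

section \<open>Projective charts\<close>

lemma proj_class_eq_iff:
  assumes "u \<noteq> 0" "v \<noteq> 0"
  shows "proj_class u = proj_class v \<longleftrightarrow> (\<exists>c. c \<noteq> 0 \<and> u = c *\<^sub>R v)"
  unfolding proj_class_def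
  using assms eq_equiv_class_iff[OF equiv_proj_rel, of u v] by (simp add: proj_rel_def)

text \<open>With u = T (s, z), the classes agree iff (s, z) is a nonzero multiple of (1, w), that
  is, s is nonzero and w = z / s. Domain and value of the chart both follow from this.\<close>

lemma proj_class_eq_chart_point:
  fixes T :: "real \<times> (real^'m) \<Rightarrow> real^'n"
  assumes T: "linear T" "bij T" and u: "u \<noteq> 0"
  shows "proj_class u = proj_class (T (1, w)) \<longleftrightarrow>
    fst (inv T u) \<noteq> 0 \<and> w = inverse (fst (inv T u)) *\<^sub>R snd (inv T u)"
proof -
  obtain s z where sz: "inv T u = (s, z)" by fastforce
  then have u_eq: "u = T (s, z)"
    using T(2) by (metis bij_inv_eq_iff)
  have "T (1, w) \<noteq> 0"
    using T by (metis bij_is_inj linear_injective_0 one_neq_zero prod.inject zero_prod_def)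
  then have "proj_class u = proj_class (T (1, w)) \<longleftrightarrow> (\<exists>c. c \<noteq> 0 \<and> T (s, z) = c *\<^sub>R T (1, w))"
    using u by (simp add: proj_class_eq_iff u_eq)
  also have "\<dots> \<longleftrightarrow> (\<exists>c. c \<noteq> 0 \<and> (s, z) = c *\<^sub>R (1, w))"
    by (simp add: linear_cmul[OF T(1), symmetric] inj_eq[OF bij_is_inj[OF T(2)]])
  also have "\<dots> \<longleftrightarrow> s \<noteq> 0 \<and> w = inverse s *\<^sub>R z"
    by (auto simp: scaleR_prod_def)
  finally show ?thesis by (simp add: sz)
qed

lemma proj_chart_dom:
  fixes T :: "real \<times> (real^'m) \<Rightarrow> real^'n"
  assumes "linear T" "bij T" "u \<noteq> 0"
  shows "proj_class u \<in> fst (proj_chart T) \<longleftrightarrow> fst (inv T u) \<noteq> 0"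
  using proj_class_eq_chart_point[OF assms] by (auto simp: proj_chart_def)

lemma proj_chart_apply:
  fixes T :: "real \<times> (real^'m) \<Rightarrow> real^'n"
  assumes "linear T" "bij T" "u \<noteq> 0" "fst (inv T u) \<noteq> 0"
  shows "snd (proj_chart T) (proj_class u) = inverse (fst (inv T u)) *\<^sub>R snd (inv T u)"
  using proj_class_eq_chart_point[OF assms(1-3)] assms(4) by (simp add: proj_chart_def)

section \<open>Grassmann charts and the moving basis of a graph\<close>

lemma inj_graph_plane:
  fixes T :: "(real^'k) \<times> (real^'m) \<Rightarrow> real^'n"
  assumes "inj T"
  shows "inj (graph_plane T)"
proof (rule injI)
  fix A B assume "graph_plane T A = graph_plane T B"
  then have "range (\<lambda>x. (x, A *v x)) = range (\<lambda>x. (x, B *v x))"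
    using assms by (simp add: graph_plane_def inj_image_eq_iff)
  \<comment> \<open>A graph contains exactly one point over each \<open>x\<close>.\<close>
  then have "A *v x = B *v x" for x
    by (metis (no_types, lifting) Pair_inject rangeE rangeI)
  then show "A = B" by (simp add: matrix_eq)
qed

lemma fst_grassmann_chart: "fst (grassmann_chart T) = range (graph_plane T)"
  by (simp add: grassmann_chart_def)

lemma snd_grassmann_chart:
  assumes "inj T"
  shows "snd (grassmann_chart T) (graph_plane T A) = A"
  using inj_graph_plane[OF assms] by (simp add: grassmann_chart_def inj_eq)

lemma inv_into_grassmann_chart:
  assumes "inj T"
  shows "inv_into (fst (grassmann_chart T)) (snd (grassmann_chart T)) A = graph_plane T A"
  using inv_into_f_f[of "snd (grassmann_chart T)" "fst (grassmann_chart T)" "graph_plane T A"]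
  by (simp add: fst_grassmann_chart snd_grassmann_chart[OF assms] inj_on_def)

text \<open>For k = 2, the vectors with j = 1 and j = 2 are the basis of
  \<open>graph_plane T A\<close> in which the map is computed.\<close>

definition graph_vec :: "((real^'k) \<times> (real^'m) \<Rightarrow> real^'n) \<Rightarrow> 'k \<Rightarrow> real^'k^'m \<Rightarrow> real^'n" where
  "graph_vec T j A = T (axis j 1, A *v axis j 1)"

lemma graph_vec_comb:
  fixes T :: "(real^2) \<times> (real^'m) \<Rightarrow> real^'n"
  assumes "linear T"
  shows "a *\<^sub>R graph_vec T 1 A + b *\<^sub>R graph_vec T 2 A = T (vector [a, b], A *v vector [a, b])"
proof -
  have "vector [a, b] = a *\<^sub>R axis 1 1 + (b *\<^sub>R axis 2 1 :: real^2)"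
    by (simp add: vec_eq_iff forall_2 axis_def)
  then show ?thesis
    by (simp add: graph_vec_def linear_cmul[OF assms, symmetric] linear_add[OF assms, symmetric]
        matrix_vector_right_distrib matrix_vector_mult_scaleR)
qed

text \<open>The first component of a combination, read through \<open>T\<close>, is the coefficient
  vector (a, b) itself.\<close>

lemma graph_vec_independent:
  fixes T :: "(real^2) \<times> (real^'m) \<Rightarrow> real^'n"
  assumes "linear T" "inj T"
  shows "graph_vec T 1 A \<noteq> graph_vec T 2 A \<and> independent {graph_vec T 1 A, graph_vec T 2 A}"
  unfolding independent_pair_iff
proof (intro allI impI)
  fix a b assume "a *\<^sub>R graph_vec T 1 A + b *\<^sub>R graph_vec T 2 A = 0"
  then have "T (vector [a, b], A *v vector [a, b]) = 0"
    by (simp add: graph_vec_comb assms)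
  then have "(vector [a, b] :: real^2) = 0"
    using assms by (metis linear_injective_0 fst_conv fst_zero)
  then show "a = 0 \<and> b = 0"
    by (metis vector_2 zero_index)
qed

lemma graph_plane_eq_span:
  fixes T :: "(real^2) \<times> (real^'m) \<Rightarrow> real^'n"
  assumes "linear T"
  shows "graph_plane T A = span {graph_vec T 1 A, graph_vec T 2 A}"
proof -
  have "graph_plane T A = {T (x, A *v x) |x. True}"
    by (auto simp: graph_plane_def)
  also have "\<dots> = {T (vector [a, b], A *v vector [a, b]) |a b. True}"
    using forall_vector_2[where P = "\<lambda>x::real^2. \<exists>a b. x = vector [a, b]"]
    by (intro equalityI subsetI) (clarsimp, metis)+
  finally show ?thesis
    by (simp add: span_pair graph_vec_comb assms)
qed

text \<open>Separates the constant from the part linear in \<open>A\<close>; smoothness and the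
  derivative are read off from this.\<close>

lemma graph_vec_affine:
  fixes T :: "(real^'k) \<times> (real^'m) \<Rightarrow> real^'n"
  assumes "linear T"
  shows "graph_vec T j A = T (axis j 1, 0) + T (0, A *v axis j 1)"
  by (simp add: graph_vec_def linear_add[OF assms, symmetric])

lemma linear_graph_vec_part:
  fixes T :: "(real^'k) \<times> (real^'m) \<Rightarrow> real^'n" and j :: 'k
  assumes "linear T"
  shows "linear (\<lambda>A. T (0, A *v axis j 1))"
proof -
  have "linear (\<lambda>A::real^'k^'m. (0::real^'k, A *v axis j 1 :: real^'m))"
    by (auto simp: linear_iff matrix_vector_mult_add_rdistrib scaleR_matrix_vector_assoc)
  then show ?thesis
    using linear_compose[OF _ assms, unfolded o_def] by blast
qed

lemma Ck_on_graph_vec: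
  fixes T :: "(real^'k) \<times> (real^'m) \<Rightarrow> real^'n"
  assumes "linear T" "open S"
  shows "Ck_on k S (graph_vec T j)"
proof -
  have "Ck_on k S (\<lambda>A. T (axis j 1, 0) + T (0, A *v axis j 1))"
    by (intro Ck_on_add Ck_on_const Ck_on_linear linear_graph_vec_part assms)
  then show ?thesis
    by (simp add: graph_vec_affine[OF assms(1), abs_def])
qed

lemma has_derivative_graph_vec:
  fixes T :: "(real^'k) \<times> (real^'m) \<Rightarrow> real^'n"
  assumes "linear T"
  shows "(graph_vec T j has_derivative (\<lambda>H. T (0, H *v axis j 1))) F"
proof -
  have "((\<lambda>A. T (axis j 1, 0) + T (0, A *v axis j 1)) has_derivative (\<lambda>H. 0 + T (0, H *v axis j 1))) F"
    by (intro has_derivative_add has_derivative_const linear_imp_has_derivative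
        linear_graph_vec_part assms)
  then show ?thesis
    by (simp add: graph_vec_affine[OF assms, abs_def])
qed

section \<open>Maps on planes induced by alternating bilinear maps\<close>

section \<open>Nondegenerate alternating maps\<close>

locale nondegenerate_alternating =
  fixes B :: "real^'n \<Rightarrow> real^'n \<Rightarrow> real^'w"
  assumes bilinear: "bilinear B"
    and alternating: "B x x = 0"
    and nondegenerate: "x \<noteq> y \<Longrightarrow> independent {x, y} \<Longrightarrow> B x y \<noteq> 0"
begin

text \<open>Has the shape of \<open>nu4\<close> and \<open>nu8\<close>, so that both become
  instances by unfolding.\<close>

definition plane_map :: "(real^'n) set \<Rightarrow> (real^'w) set" where
  "plane_map L = (THE c. \<exists>x y. x \<noteq> y \<and> independent {x, y} \<and> L = span {x, y} \<and> c = proj_class (B x y))"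

lemmas B_add = bilinear_ladd[OF bilinear] bilinear_radd[OF bilinear]
lemmas B_scale = bilinear_lmul[OF bilinear] bilinear_rmul[OF bilinear]

lemma skew: "B y x = - B x y"
proof -
  have "B x y + B y x = B (x + y) (x + y)"
    unfolding B_add by (simp add: alternating)
  then have "B x y + B y x = 0"
    by (simp only: alternating)
  then show ?thesis
    by (rule minus_unique[symmetric])
qed

text \<open>The factor is the determinant of the change of basis.\<close>

lemma B_change_basis:
  "B (a *\<^sub>R x + b *\<^sub>R y) (c *\<^sub>R x + d *\<^sub>R y) = (a * d - b * c) *\<^sub>R B x y"
  by (simp add: B_add B_scale alternating skew[of y x] algebra_simps)

text \<open>Values of \<open>B\<close> on two bases of one plane differ by a determinant, which is
  nonzero because both values are; hence the class is independent of the basis.\<close>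

lemma plane_map_span:
  assumes xy: "x \<noteq> y" "independent {x, y}"
  shows "plane_map (span {x, y}) = proj_class (B x y)"
  unfolding plane_map_def
proof (rule the_equality)
  fix c assume "\<exists>x' y'. x' \<noteq> y' \<and> independent {x', y'} \<and> span {x, y} = span {x', y'} \<and> c = proj_class (B x' y')"
  then obtain x' y' where *: "x' \<noteq> y'" "independent {x', y'}" "span {x, y} = span {x', y'}"
    and c: "c = proj_class (B x' y')" by blast
  have "x' \<in> span {x, y}" "y' \<in> span {x, y}"
    unfolding *(3) by (auto intro: span_base)
  then obtain a b d e where "x' = a *\<^sub>R x + b *\<^sub>R y" "y' = d *\<^sub>R x + e *\<^sub>R y"
    unfolding span_pair by blast
  then have "B x' y' = (a * e - b * d) *\<^sub>R B x y"
    by (simp only: B_change_basis)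
  moreover have "B x' y' \<noteq> 0" "B x y \<noteq> 0"
    using * xy nondegenerate by blast+
  ultimately show "c = proj_class (B x y)"
    unfolding c by (subst proj_class_eq_iff) auto
qed (use xy in blast)

lemma plane_map_graph_plane:
  fixes T :: "(real^2) \<times> (real^'m) \<Rightarrow> real^'n"
  assumes "linear T" "inj T"
  shows "plane_map (graph_plane T A) = proj_class (B (graph_vec T 1 A) (graph_vec T 2 A))"
  using graph_vec_independent[OF assms] by (simp add: graph_plane_eq_span[OF assms(1)] plane_map_span)

text \<open>By nondegeneracy \<open>B x\<close> is injective on the orthogonal complement of
  \<open>x\<close>, whose dimension is that of the target.\<close>

lemma surj_B:
  assumes "x \<noteq> 0" "CARD('n) = CARD('w) + 1"
  shows "surj (B x)"
proof -
  have lin: "linear (B x)"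
    using bilinear by (simp add: bilinear_def)
  define C where "C = {y. orthogonal x y}"
  have C: "subspace C"
    using subspace_orthogonal_to_vector[of x] by (simp add: C_def)
  have "dim {y \<in> UNIV. \<forall>z\<in>span {x}. orthogonal z y} + dim (span {x}) = dim (UNIV :: (real^'n) set)"
    by (rule dim_subspace_orthogonal_to_vectors) auto
  moreover have "{y \<in> UNIV. \<forall>z\<in>span {x}. orthogonal z y} = C"
    by (auto simp: C_def span_singleton orthogonal_def intro!: exI[of _ 1])
  ultimately have dimC: "dim C = CARD('w)"
    using assms by (simp add: dim_UNIV dim_span)
  have "y = 0" if "y \<in> C" "B x y = 0" for y
  proof (rule ccontr)
    assume y: "y \<noteq> 0"
    have xy: "x \<bullet> y = 0" using that by (simp add: C_def orthogonal_def)
    \<comment> \<open>Nonzero orthogonal vectors are independent: pair the relation with each of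
      them.\<close>
    have "\<forall>a b. a *\<^sub>R x + b *\<^sub>R y = 0 \<longrightarrow> a = 0 \<and> b = 0"
    proof (intro allI impI)
      fix a b assume 0: "a *\<^sub>R x + b *\<^sub>R y = 0"
      have "x \<bullet> (a *\<^sub>R x + b *\<^sub>R y) = 0" "y \<bullet> (a *\<^sub>R x + b *\<^sub>R y) = 0"
        unfolding 0 by simp_all
      then show "a = 0 \<and> b = 0"
        using xy y assms(1) by (simp add: inner_add_right inner_commute)
    qed
    then show False
      using nondegenerate that(2) independent_pair_iff by metis
  qed
  then have "inj_on (B x) C"
    using linear_inj_on_iff_eq_0[OF lin C] by blast
  then have "dim (B x ` C) = CARD('w)"
    using dim_image_eq[OF lin, of C] C dimC by (simp add: span_eq_iff[THEN iffD2])
  then have "span (B x ` C) = UNIV"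
    by (intro dim_eq_full[THEN iffD1]) simp
  moreover have "span (B x ` C) = B x ` C"
    using linear_subspace_image[OF lin C] by (simp add: span_eq_iff)
  ultimately show ?thesis by blast
qed

end

section \<open>The map read in one Grassmann chart and one projective chart\<close>

locale chart_pair = nondegenerate_alternating B
  for B :: "real^'n \<Rightarrow> real^'n \<Rightarrow> real^'w" +
  fixes T :: "(real^2) \<times> (real^'m) \<Rightarrow> real^'n" and S :: "real \<times> (real^'m) \<Rightarrow> real^'w"
  assumes T: "linear T" "bij T" and S: "linear S" "bij S"
begin

abbreviation X :: "real^2^'m \<Rightarrow> real^'n" where "X \<equiv> graph_vec T 1"
abbreviation Y :: "real^2^'m \<Rightarrow> real^'n" where "Y \<equiv> graph_vec T 2"

text \<open>\<open>p\<close> and \<open>q\<close> are the homogeneous coordinates of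
  \<open>B x y\<close> with respect to \<open>S\<close>: denominator and numerator of the affine
  chart.\<close>

definition p :: "real^'n \<Rightarrow> real^'n \<Rightarrow> real" where "p x y = fst (inv S (B x y))"
definition q :: "real^'n \<Rightarrow> real^'n \<Rightarrow> real^'m" where "q x y = snd (inv S (B x y))"
definition D :: "(real^2^'m) set" where "D = {A. p (X A) (Y A) \<noteq> 0}"
text \<open>The local representative in closed form; it carries this meaning only on
  \<open>D\<close>, since \<open>inverse\<close> is 0 at 0.\<close>

definition R :: "real^2^'m \<Rightarrow> real^'m" where
  "R A = inverse (p (X A) (Y A)) *\<^sub>R q (X A) (Y A)"

lemma inj_T: "inj T" and inj_S: "inj S"
  using T S by (auto simp: bij_is_inj)

lemma linear_inv_S: "linear (inv S)"
proof (rule linearI)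
  have S_inv: "S (inv S u) = u" for u
    using S(2) by (simp add: bij_is_surj surj_f_inv_f)
  show "inv S (u + v) = inv S u + inv S v" for u v
    by (rule inv_f_eq[OF inj_S]) (simp add: linear_add[OF S(1)] S_inv)
  show "inv S (c *\<^sub>R u) = c *\<^sub>R inv S u" for c u
    by (rule inv_f_eq[OF inj_S]) (simp add: linear_cmul[OF S(1)] S_inv)
qed

lemma bounded_bilinear_p: "bounded_bilinear p" and bounded_bilinear_q: "bounded_bilinear q"
proof -
  have "bilinear p" "bilinear q"
    using bilinear linear_inv_S
    by (simp_all add: p_def[abs_def] q_def[abs_def] bilinear_def linear_iff)
  then show "bounded_bilinear p" "bounded_bilinear q"
    by (simp_all add: bilinear_conv_bounded_bilinear)
qed

lemma B_nonzero: "B (X A) (Y A) \<noteq> 0"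
  using graph_vec_independent[OF T(1) inj_T] nondegenerate by blast

lemma plane_map_dom: "plane_map (graph_plane T A) \<in> fst (proj_chart S) \<longleftrightarrow> A \<in> D"
  by (simp add: plane_map_graph_plane[OF T(1) inj_T] proj_chart_dom[OF S B_nonzero] D_def p_def)

lemma local_dom: "local_dom (grassmann_chart T) (proj_chart S) plane_map = D"
proof -
  have "{P \<in> fst (grassmann_chart T). plane_map P \<in> fst (proj_chart S)} = graph_plane T ` D"
    by (auto simp: fst_grassmann_chart plane_map_dom)
  then show ?thesis
    by (simp add: local_dom_def image_image snd_grassmann_chart[OF inj_T])
qed

lemma local_rep:
  assumes "A \<in> D"
  shows "local_rep (grassmann_chart T) (proj_chart S) plane_map A = R A"
proof -
  have "fst (inv S (B (X A) (Y A))) \<noteq> 0"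
    using assms by (simp add: D_def p_def)
  from proj_chart_apply[OF S B_nonzero this] show ?thesis
    by (simp only: local_rep_def o_apply inv_into_grassmann_chart[OF inj_T]
        plane_map_graph_plane[OF T(1) inj_T] R_def p_def q_def)
qed

lemma Ck_on_pq:
  assumes "open U"
  shows "Ck_on k U (\<lambda>A. p (X A) (Y A))" "Ck_on k U (\<lambda>A. q (X A) (Y A))"
proof -
  have XY: "Ck_on k U X" "Ck_on k U Y"
    using Ck_on_graph_vec[OF T(1) assms] by blast+
  show "Ck_on k U (\<lambda>A. p (X A) (Y A))"
    using Ck_on_bounded_bilinear[OF assms bounded_bilinear_p XY] .
  show "Ck_on k U (\<lambda>A. q (X A) (Y A))"
    using Ck_on_bounded_bilinear[OF assms bounded_bilinear_q XY] .
qed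

lemma open_D: "open D"
proof -
  \<comment> \<open>Class C^0 is continuity by definition.\<close>
  have "continuous_on UNIV (\<lambda>A. p (X A) (Y A))"
    using Ck_on_pq(1)[OF open_UNIV, of 0] unfolding Ck_on.simps(1) .
  then show ?thesis
    unfolding D_def by (rule open_Collect_neq[OF _ continuous_on_const])
qed

lemma smooth_on_local_rep: "smooth_on D (local_rep (grassmann_chart T) (proj_chart S) plane_map)"
  unfolding smooth_on_def
proof
  fix k
  have "Ck_on k D R"
    unfolding R_def[abs_def]
    by (rule Ck_on_bounded_bilinear[OF open_D bounded_bilinear_scaleR
          Ck_on_inverse[OF open_D _ Ck_on_pq(1)[OF open_D]] Ck_on_pq(2)[OF open_D]])
       (simp add: D_def)
  then show "Ck_on k D (local_rep (grassmann_chart T) (proj_chart S) plane_map)"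
    using Ck_on_cong[OF open_D, of _ R k] local_rep by blast
qed

text \<open>The product rule for q / p. The two columns of \<open>H\<close> move \<open>X\<close>
  and \<open>Y\<close> separately, with velocities \<open>x'\<close> and \<open>y'\<close> in the
  image of the second factor. The terms are arranged as the derivative rules produce them.\<close>

definition R' :: "real^2^'m \<Rightarrow> real^2^'m \<Rightarrow> real^'m" where
  "R' A H = (let x = X A; y = Y A; x' = T (0, H *v axis 1 1); y' = T (0, H *v axis 2 1) in
     inverse (p x y) *\<^sub>R (q x y' + q x' y) +
     (- (inverse (p x y) * (p x y' + p x' y) * inverse (p x y))) *\<^sub>R q x y)"

lemma has_derivative_R:
  assumes "A \<in> D"
  shows "(R has_derivative R' A) (at A)"
  unfolding R_def[abs_def] R'_def[abs_def] Let_def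
  using assms unfolding D_def
  by (intro bounded_bilinear.FDERIV[OF bounded_bilinear_scaleR] Deriv.has_derivative_inverse
      bounded_bilinear.FDERIV[OF bounded_bilinear_p] bounded_bilinear.FDERIV[OF bounded_bilinear_q]
      has_derivative_graph_vec T) simp

text \<open>Fix \<open>X\<close> and move \<open>Y\<close> alone. A velocity reaching
  \<open>z\<close> is found in R^n first, then corrected into the second factor; the correction
  changes \<open>B\<close> by a multiple of \<open>B x y\<close>, which the quotient does not
  see.\<close>

lemma surj_R':
  assumes A: "A \<in> D" and card: "CARD('n) = CARD('w) + 1"
  shows "surj (R' A)"
proof -
  have "\<exists>H. R' A H = z" for z
  proof -
    define x y where "x = X A" and "y = Y A"
    define P where "P = p x y"
    have P: "P \<noteq> 0"
      using A by (simp add: D_def P_def x_def y_def)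
    have "x \<noteq> 0"
      using B_nonzero[of A] bilinear_lzero[OF bilinear] by (auto simp: x_def)
    \<comment> \<open>Chosen so that \<open>p x v = 0\<close> and
      \<open>q x v = P *\<^sub>R z\<close>: with \<open>v\<close> as velocity of \<open>Y\<close>,
      the quotient rule would give exactly \<open>z\<close>.\<close>
    then obtain v where v: "B x v = S (0, P *\<^sub>R z)"
      using surj_B[OF _ card] by (metis surjD)
    obtain v1 v2 where v12: "v = T (v1, v2)"
      using T(2) by (metis bij_pointE surj_pair)
    define b where "b = v1 $ 2"
    \<comment> \<open>Subtracting the point of the graph over \<open>v1\<close> leaves
      \<open>T (0, r)\<close>; that point is a combination of \<open>x\<close> and \<open>y\<close>
      in which \<open>y\<close> has coefficient \<open>b\<close>.\<close>
    define r where "r = v2 - A *v v1"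
    \<comment> \<open>First column 0 keeps \<open>X\<close> fixed, second column \<open>r\<close>
      moves \<open>Y\<close> by \<open>T (0, r)\<close>.\<close>
    define H :: "real^2^'m" where "H = (\<chi> i j. if j = 2 then r $ i else 0)"
    have H: "H *v axis 1 1 = 0" "H *v axis 2 1 = r"
      by (simp_all add: vec_eq_iff H_def matrix_vector_mult_basis column_def)
    have "v1 = vector [v1 $ 1, b]"
      by (simp add: vec_eq_iff forall_2 b_def)
    then have "v1 $ 1 *\<^sub>R x + b *\<^sub>R y = T (v1, A *v v1)"
      by (metis x_def y_def graph_vec_comb[OF T(1)])
    then have "v = v1 $ 1 *\<^sub>R x + b *\<^sub>R y + T (0, r)"
      by (simp add: v12 r_def linear_add[OF T(1), symmetric])
    then have "B x v = b *\<^sub>R B x y + B x (T (0, r))"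
      by (simp add: B_add B_scale alternating)
    then have "B x (T (0, r)) = S (0, P *\<^sub>R z) - b *\<^sub>R B x y"
      using v by simp
    then have "inv S (B x (T (0, r))) = (0, P *\<^sub>R z) - b *\<^sub>R inv S (B x y)"
      by (simp add: linear_diff[OF linear_inv_S] linear_cmul[OF linear_inv_S] inv_f_f[OF inj_S])
    then have pq: "p x (T (0, r)) = - b * P" "q x (T (0, r)) = P *\<^sub>R z - b *\<^sub>R q x y"
      by (simp_all add: p_def q_def P_def)
    have "T (0, 0) = 0"
      using linear_0[OF T(1)] by (simp add: zero_prod_def)
    then have "R' A H = inverse P *\<^sub>R (P *\<^sub>R z - b *\<^sub>R q x y) +
        (- (inverse P * (- b * P) * inverse P)) *\<^sub>R q x y"
      by (simp add: R'_def x_def[symmetric] y_def[symmetric] P_def[symmetric] H pq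
          bounded_bilinear.zero_left[OF bounded_bilinear_p] bounded_bilinear.zero_left[OF bounded_bilinear_q])
    \<comment> \<open>The two terms in \<open>q x y\<close> have coefficients -b/P and b/P and
      cancel.\<close>
    also have "\<dots> = z"
      using P by (simp add: algebra_simps)
    finally show ?thesis ..
  qed
  then show ?thesis by (metis surjI)
qed

lemma surj_derivative_local_rep:
  assumes A: "A \<in> D" and card: "CARD('n) = CARD('w) + 1"
  shows "surj (frechet_derivative (local_rep (grassmann_chart T) (proj_chart S) plane_map) (at A))"
proof -
  have "(local_rep (grassmann_chart T) (proj_chart S) plane_map has_derivative R' A) (at A)"
    by (rule has_derivative_transform_within_open[OF has_derivative_R[OF A] open_D A]) (simp add: local_rep)
  then show ?thesis
    using surj_R'[OF assms] by (simp add: frechet_derivative_at[symmetric])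
qed

end

section \<open>From pairs of charts to the whole atlases\<close>

context nondegenerate_alternating
begin

lemma plane_map_in_proj_space:
  assumes "L \<in> grassmannian 2"
  shows "plane_map L \<in> proj_space"
proof -
  have L: "subspace L" "dim L = 2"
    using assms by (auto simp: grassmannian_def)
  obtain b where b: "b \<subseteq> L" "independent b" "L \<subseteq> span b" "card b = 2"
    using basis_exists[of L] L(2) by metis
  then obtain x y where xy: "b = {x, y}" "x \<noteq> y"
    by (meson card_2_iff)
  have "L = span {x, y}"
    using b L(1) xy by (metis span_subspace)
  then have "plane_map L = proj_class (B x y)"
    using plane_map_span b xy by simp
  moreover have "B x y \<noteq> 0"
    using nondegenerate b xy by blast
  ultimately show ?thesis
    by (auto simp: proj_space_def proj_class_def intro: quotientI)
qed

text \<open>Every pair of charts comes from some \<open>T\<close> and \<open>S\<close>, which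
  instantiate \<open>chart_pair\<close>; \<open>card\<close> enters through the surjectivity of
  \<open>B x\<close>.\<close>

theorem submersion_plane_map:
  assumes card: "CARD('n) = CARD('w) + 1"
  shows "submersion
    (grassmannian 2) (grassmann_atlas :: ((real^'n) set, real^2^'m::finite) chart set)
    proj_space (proj_atlas :: ((real^'w) set, real^'m) chart set)
    plane_map"
  unfolding submersion_def smooth_map_def
proof (intro conjI ballI impI image_subsetI plane_map_in_proj_space)
  fix c :: "((real^'n) set, real^2^'m) chart" and d :: "((real^'w) set, real^'m) chart"
  assume "c \<in> grassmann_atlas" "d \<in> proj_atlas"
  then obtain T S where TS: "linear T" "bij T" "linear S" "bij S"
    and c: "c = grassmann_chart T" and d: "d = proj_chart S"
    by (auto simp: grassmann_atlas_def proj_atlas_def)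
  interpret chart_pair B T S
    by (intro chart_pair.intro chart_pair_axioms.intro nondegenerate_alternating_axioms TS)
  show "open (local_dom c d plane_map)" "smooth_on (local_dom c d plane_map) (local_rep c d plane_map)"
    by (simp_all add: c d local_dom open_D smooth_on_local_rep)
  fix L assume L: "L \<in> fst c" "plane_map L \<in> fst d"
  then obtain A where A: "L = graph_plane T A"
    by (auto simp: c fst_grassmann_chart)
  then have "A \<in> D"
    using L(2) by (simp add: d plane_map_dom)
  then show "surj (frechet_derivative (local_rep c d plane_map) (at (snd c L)))"
    by (simp add: A c d snd_grassmann_chart[OF inj_T] surj_derivative_local_rep card)
qed

end

section \<open>Quaternions and octonions\<close>

lemma exhaust_7:
  fixes x :: 7
  shows "x = 1 \<or> x = 2 \<or> x = 3 \<or> x = 4 \<or> x = 5 \<or> x = 6 \<or> x = 7"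
proof (induct x)
  case (of_int z)
  then have "z = 0 \<or> z = 1 \<or> z = 2 \<or> z = 3 \<or> z = 4 \<or> z = 5 \<or> z = 6" by fastforce
  then show ?case by auto
qed

lemma exhaust_8:
  fixes x :: 8
  shows "x = 0 \<or> x = 1 \<or> x = 2 \<or> x = 3 \<or> x = 4 \<or> x = 5 \<or> x = 6 \<or> x = 7"
proof (induct x)
  case (of_int z)
  then have "z = 0 \<or> z = 1 \<or> z = 2 \<or> z = 3 \<or> z = 4 \<or> z = 5 \<or> z = 6 \<or> z = 7" by fastforce
  then show ?case by auto
qed

lemma forall_7: "(\<forall>i::7. P i) \<longleftrightarrow> P 1 \<and> P 2 \<and> P 3 \<and> P 4 \<and> P 5 \<and> P 6 \<and> P 7"
  by (metis exhaust_7)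

lemma forall_8: "(\<forall>i::8. P i) \<longleftrightarrow> P 0 \<and> P 1 \<and> P 2 \<and> P 3 \<and> P 4 \<and> P 5 \<and> P 6 \<and> P 7"
  by (metis exhaust_8)

text \<open>In the type \<open>4\<close> the numeral 4 equals 0, so the range 1 to 4 can be
  relabelled to begin at the index of the unit.\<close>

lemma forall_4_from_0: "(\<forall>i::4. P i) \<longleftrightarrow> P 0 \<and> P 1 \<and> P 2 \<and> P 3"
proof -
  have "(4::4) = 0" by simp
  then show ?thesis using forall_4[of P] by metis
qed

lemma UNIV_8: "UNIV = {0, 1, 2, 3, 4, 5, 6, 7::8}"
  using exhaust_8 by auto

lemma sum_8: "sum f (UNIV::8 set) = f 0 + f 1 + f 2 + f 3 + f 4 + f 5 + f 6 + f 7"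
  unfolding UNIV_8 by (simp add: ac_simps)

lemma sum_4_from_0: "sum f (UNIV::4 set) = f 0 + f 1 + f 2 + f 3"
proof -
  have "(4::4) = 0" by simp
  then show ?thesis using sum_4[of f] by (simp only: ac_simps)
qed

lemma vector_7:
  fixes a b c d e f g :: "'a::zero"
  defines "v \<equiv> vector [a, b, c, d, e, f, g] :: 'a^7"
  shows "v $ 1 = a" "v $ 2 = b" "v $ 3 = c" "v $ 4 = d" "v $ 5 = e" "v $ 6 = f" "v $ 7 = g"
  unfolding v_def vector_def by simp_all

lemma quat_mult_nth:
  "quat_mult x y $ 0 = x$0 * y$0 - x$1 * y$1 - x$2 * y$2 - x$3 * y$3"
  "quat_mult x y $ 1 = x$0 * y$1 + x$1 * y$0 + x$2 * y$3 - x$3 * y$2"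
  "quat_mult x y $ 2 = x$0 * y$2 + x$2 * y$0 + x$3 * y$1 - x$1 * y$3"
  "quat_mult x y $ 3 = x$0 * y$3 + x$3 * y$0 + x$1 * y$2 - x$2 * y$1"
  by (simp_all add: quat_mult_def algebra_mult_def sum_4_from_0 struct_coeff_def cyclic_closure_def)

text \<open>With the product in coordinates, the octonion identities below become polynomial
  identities.\<close>

lemma oct_mult_nth:
  "oct_mult x y $ 0 = x$0 * y$0 - x$1 * y$1 - x$2 * y$2 - x$3 * y$3
     - x$4 * y$4 - x$5 * y$5 - x$6 * y$6 - x$7 * y$7"
  "oct_mult x y $ 1 = x$0 * y$1 + x$1 * y$0 + (x$2 * y$3 - x$3 * y$2)
     + (x$4 * y$5 - x$5 * y$4) + (x$7 * y$6 - x$6 * y$7)"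
  "oct_mult x y $ 2 = x$0 * y$2 + x$2 * y$0 + (x$3 * y$1 - x$1 * y$3)
     + (x$4 * y$6 - x$6 * y$4) + (x$5 * y$7 - x$7 * y$5)"
  "oct_mult x y $ 3 = x$0 * y$3 + x$3 * y$0 + (x$1 * y$2 - x$2 * y$1)
     + (x$4 * y$7 - x$7 * y$4) + (x$6 * y$5 - x$5 * y$6)"
  "oct_mult x y $ 4 = x$0 * y$4 + x$4 * y$0 + (x$5 * y$1 - x$1 * y$5)
     + (x$6 * y$2 - x$2 * y$6) + (x$7 * y$3 - x$3 * y$7)"
  "oct_mult x y $ 5 = x$0 * y$5 + x$5 * y$0 + (x$1 * y$4 - x$4 * y$1)
     + (x$7 * y$2 - x$2 * y$7) + (x$3 * y$6 - x$6 * y$3)"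
  "oct_mult x y $ 6 = x$0 * y$6 + x$6 * y$0 + (x$1 * y$7 - x$7 * y$1)
     + (x$2 * y$4 - x$4 * y$2) + (x$5 * y$3 - x$3 * y$5)"
  "oct_mult x y $ 7 = x$0 * y$7 + x$7 * y$0 + (x$6 * y$1 - x$1 * y$6)
     + (x$2 * y$5 - x$5 * y$2) + (x$3 * y$4 - x$4 * y$3)"
  by (simp_all add: oct_mult_def algebra_mult_def sum_8 struct_coeff_def cyclic_closure_def)

section \<open>Conjugation identities and nondegeneracy\<close>

lemma quat_mult_conj_mult: "quat_mult (quat_mult y (hc_conj x)) x = (x \<bullet> x) *\<^sub>R y"
  by (simp add: vec_eq_iff forall_4_from_0 quat_mult_nth hc_conj_def inner_vec_def sum_4_from_0 algebra_simps)

text \<open>Octonions are not associative but alternative, and \<open>hc_conj x\<close> is a real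
  combination of the unit and \<open>x\<close>, so this bracketing still gives the norm. The check
  is by coordinates.\<close>

lemma oct_mult_conj_mult: "oct_mult (oct_mult y (hc_conj x)) x = (x \<bullet> x) *\<^sub>R y"
  by (simp add: vec_eq_iff forall_8 oct_mult_nth hc_conj_def inner_vec_def sum_8 algebra_simps)

lemma linear_hc_conj: "linear hc_conj"
  by (auto simp: linear_iff hc_conj_def vec_eq_iff)

lemma bilinear_algebra_mult: "bilinear (algebra_mult S)"
  by (auto simp: bilinear_def linear_iff algebra_mult_def vec_eq_iff algebra_simps
      sum.distrib sum_distrib_left)

lemma linear_pure_quat: "linear pure_quat"
  by (auto simp: linear_iff pure_quat_def vec_eq_iff forall_3)

lemma linear_pure_oct: "linear pure_oct"
  by (auto simp: linear_iff pure_oct_def vec_eq_iff forall_7 vector_7)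

lemma quat_conj_mult: "hc_conj (quat_mult y (hc_conj x)) = quat_mult x (hc_conj y)"
  by (simp add: vec_eq_iff forall_4_from_0 quat_mult_nth hc_conj_def algebra_simps)

text \<open>Makes half the difference in the definition of the map the imaginary part of
  \<open>oct_mult y (hc_conj x)\<close>.\<close>

lemma oct_conj_mult: "hc_conj (oct_mult y (hc_conj x)) = oct_mult x (hc_conj y)"
  by (simp add: vec_eq_iff forall_8 oct_mult_nth hc_conj_def algebra_simps)

lemma algebra_mult_unit: "algebra_mult S (axis 0 1) x = x"
proof -
  have "(\<Sum>j\<in>UNIV. (axis 0 1 :: (real, 'a) vec) $ i * x $ j * struct_coeff S i j k)
      = (if i = 0 then x $ k else 0)" for i k
  proof (cases "i = 0")
    case True
    then have "(axis 0 1 :: (real, 'a) vec) $ i * x $ j * struct_coeff S i j k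
        = (if j = k then x $ j else 0)" for j
      by (simp add: axis_def struct_coeff_def)
    with True show ?thesis by simp
  qed (simp add: axis_def)
  then show ?thesis
    by (simp add: algebra_mult_def vec_eq_iff)
qed

text \<open>If the imaginary part of u = y * conj x vanishes, u is a real t, and u * x = |x|^2 y
  becomes t x = |x|^2 y, which contradicts independence. Of \<open>pure\<close>, only linearity and
  a kernel inside the real line matter.\<close>

lemma nondegenerate_alternating_conj_mult:
  fixes S :: "('i::{finite,zero} \<times> 'i \<times> 'i) set" and pure :: "(real, 'i) vec \<Rightarrow> real^'w"
  defines "mul \<equiv> algebra_mult S"
  assumes pure: "linear pure" "\<And>u i. pure u = 0 \<Longrightarrow> i \<noteq> 0 \<Longrightarrow> u $ i = 0"
    and conj_mult: "\<And>x y. hc_conj (mul y (hc_conj x)) = mul x (hc_conj y)"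
    and mult_conj_mult: "\<And>x y. mul (mul y (hc_conj x)) x = (x \<bullet> x) *\<^sub>R y"
  shows "nondegenerate_alternating
    (\<lambda>x y. pure ((1/2) *\<^sub>R (mul y (hc_conj x) - mul x (hc_conj y))))"
proof
  have bil: "bilinear mul"
    by (simp add: mul_def bilinear_algebra_mult)
  note linear_simps = linear_add[OF pure(1)] linear_diff[OF pure(1)] linear_cmul[OF pure(1)]
    linear_add[OF linear_hc_conj] linear_cmul[OF linear_hc_conj]
    bilinear_ladd[OF bil] bilinear_radd[OF bil] bilinear_lmul[OF bil] bilinear_rmul[OF bil]
  show "bilinear (\<lambda>x y. pure ((1/2) *\<^sub>R (mul y (hc_conj x) - mul x (hc_conj y))))"
    by (simp add: bilinear_def linear_iff linear_simps algebra_simps)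
  show "pure ((1/2) *\<^sub>R (mul x (hc_conj x) - mul x (hc_conj x))) = 0" for x
    by (simp add: linear_0[OF pure(1)])
  fix x y :: "(real, 'i) vec"
  assume xy: "x \<noteq> y" "independent {x, y}"
  show "pure ((1/2) *\<^sub>R (mul y (hc_conj x) - mul x (hc_conj y))) \<noteq> 0"
  proof
    define u where "u = mul y (hc_conj x)"
    assume "pure ((1/2) *\<^sub>R (mul y (hc_conj x) - mul x (hc_conj y))) = 0"
    then have "pure ((1/2) *\<^sub>R (u - hc_conj u)) = 0"
      by (simp add: u_def conj_mult)
    from pure(2)[OF this] have "u $ i = 0" if "i \<noteq> 0" for i
      using that by (simp add: hc_conj_def)
    then have "u = u $ 0 *\<^sub>R axis 0 1"
      by (auto simp: vec_eq_iff axis_def)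
    then have "mul u x = u $ 0 *\<^sub>R x"
      by (metis algebra_mult_unit bilinear_lmul[OF bil] mul_def)
    then have "(- (u $ 0)) *\<^sub>R x + (x \<bullet> x) *\<^sub>R y = 0"
      by (simp add: u_def mult_conj_mult)
    then have "x \<bullet> x = 0"
      using independent_pair_iff[of x y] xy by blast
    \<comment> \<open>Now x = 0, phrased as a relation with a nonzero coefficient.\<close>
    then have "1 *\<^sub>R x + 0 *\<^sub>R y = 0"
      by simp
    then show False
      using independent_pair_iff[of x y] xy by (metis zero_neq_one)
  qed
qed

section \<open>The quaternionic and octonionic instances\<close>

interpretation quat: nondegenerate_alternating
  "\<lambda>x y. pure_quat ((1/2) *\<^sub>R (quat_mult y (hc_conj x) - quat_mult x (hc_conj y)))"
  \<comment> \<open>The general lemma speaks of \<open>algebra_mult\<close>; the product is folded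
    back afterwards so that the coordinate identities match.\<close>
  unfolding quat_mult_def
proof (rule nondegenerate_alternating_conj_mult; (unfold quat_mult_def[symmetric])?)
  fix u :: "real^4" and i :: 4
  assume "pure_quat u = 0"
  then have "pure_quat u $ 1 = 0" "pure_quat u $ 2 = 0" "pure_quat u $ 3 = 0"
    by simp_all
  then have "\<forall>i. i \<noteq> 0 \<longrightarrow> u $ i = 0"
    by (simp add: pure_quat_def forall_4_from_0)
  then show "i \<noteq> 0 \<Longrightarrow> u $ i = 0" by blast
qed (rule linear_pure_quat quat_conj_mult quat_mult_conj_mult)+

interpretation oct: nondegenerate_alternating
  "\<lambda>x y. pure_oct ((1/2) *\<^sub>R (oct_mult y (hc_conj x) - oct_mult x (hc_conj y)))"
  unfolding oct_mult_def
proof (rule nondegenerate_alternating_conj_mult; (unfold oct_mult_def[symmetric])?)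
  fix u :: "real^8" and i :: 8
  assume "pure_oct u = 0"
  then have "pure_oct u $ 1 = 0" "pure_oct u $ 2 = 0" "pure_oct u $ 3 = 0" "pure_oct u $ 4 = 0"
    "pure_oct u $ 5 = 0" "pure_oct u $ 6 = 0" "pure_oct u $ 7 = 0"
    by simp_all
  then have "\<forall>i. i \<noteq> 0 \<longrightarrow> u $ i = 0"
    by (simp add: pure_oct_def vector_7 forall_8)
  then show "i \<noteq> 0 \<Longrightarrow> u $ i = 0" by blast
qed (rule linear_pure_oct oct_conj_mult oct_mult_conj_mult)+

lemma nu4_eq: "nu4 = quat.plane_map"
  by (simp add: fun_eq_iff nu4_def quat.plane_map_def)

lemma nu8_eq: "nu8 = oct.plane_map"
  by (simp add: fun_eq_iff nu8_def oct.plane_map_def)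

theorem theorem1p3:
  shows "submersion
           (grassmannian 2) (grassmann_atlas :: ((real^4) set, real^2^2) chart set)
           proj_space (proj_atlas :: ((real^3) set, real^2) chart set)
           nu4 \<and>
         submersion
           (grassmannian 2) (grassmann_atlas :: ((real^8) set, real^2^6) chart set)
           proj_space (proj_atlas :: ((real^7) set, real^6) chart set)
           nu8"
  unfolding nu4_eq nu8_eq
  \<comment> \<open>What remains are the cardinalities 4 = 3 + 1 and 8 = 7 + 1.\<close>
  by (intro conjI quat.submersion_plane_map oct.submersion_plane_map) simp_all

end
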